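(* For every $\varepsilon>0$ there exists $t_0$ such that for every integer $t\geq t_0$ there exist a forest $F$ and a $t$-thick partition $\mathcal P$ of $V(F)$ whose maximum block average degree is at most $(\frac14+\varepsilon)t$, such that $\mathcal P$ has no independent transversal in $F$.
   Context: Graphs have no loops or parallel edges. For a graph $G$ and a partition $\mathcal P$ of $V(G)$ (whose parts are called blocks), $\mathcal P$ is $t$-thick if every block has at least $t$ vertices. An independent transversal of $\mathcal P$ in $G$ is an independent set of $G$ meeting each block of $\mathcal P$ in exactly one vertex. The degree $d(B)$ of a block $B$ is the number of edges of $G$ with precisely one endvertex in $B$, and the maximum block average degree of $\mathcal P$ is $\max_{B\in\mathcal P} d(B)/|B|$. *)

theory Defs
  imports Complex_Main "HOL-Library.Disjoint_Sets"
begin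

text \<open>Edges are two-element sets of vertices, which rules out loops and parallel edges.\<close>

definition finite_simple_graph :: "'a set \<Rightarrow> 'a set set \<Rightarrow> bool" where
  "finite_simple_graph V E \<longleftrightarrow> finite V \<and> (\<forall>e\<in>E. e \<subseteq> V \<and> card e = 2)"

text \<open>A cycle is listed by its vertices in cyclic order, each one once; the modulus
  produces the closing edge.\<close>

definition is_cycle :: "'a set set \<Rightarrow> 'a list \<Rightarrow> bool" where
  "is_cycle E c \<longleftrightarrow> length c \<ge> 3 \<and> distinct c \<and>
     (\<forall>i<length c. {c ! i, c ! (Suc i mod length c)} \<in> E)"

definition is_forest :: "'a set \<Rightarrow> 'a set set \<Rightarrow> bool" where
  "is_forest V E \<longleftrightarrow> finite_simple_graph V E \<and> \<not> (\<exists>c. is_cycle E c)"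

definition thick :: "nat \<Rightarrow> 'a set set \<Rightarrow> bool" where
  "thick t P \<longleftrightarrow> (\<forall>B\<in>P. t \<le> card B)"

definition independent_set :: "'a set \<Rightarrow> 'a set set \<Rightarrow> 'a set \<Rightarrow> bool" where
  "independent_set V E T \<longleftrightarrow> T \<subseteq> V \<and> \<not> (\<exists>e\<in>E. e \<subseteq> T)"

definition independent_transversal :: "'a set \<Rightarrow> 'a set set \<Rightarrow> 'a set set \<Rightarrow> 'a set \<Rightarrow> bool" where
  "independent_transversal V E P T \<longleftrightarrow>
     independent_set V E T \<and> (\<forall>B\<in>P. card (T \<inter> B) = 1)"

definition block_degree :: "'a set set \<Rightarrow> 'a set \<Rightarrow> nat" where
  "block_degree E B = card {e\<in>E. card (e \<inter> B) = 1}"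

text \<open>Meaningful for finite nonempty \<open>P\<close>. The empty partition (of the empty graph) has the
  empty set as an independent transversal.\<close>

definition max_block_average_degree :: "'a set set \<Rightarrow> 'a set set \<Rightarrow> real" where
  "max_block_average_degree E P = Max ((\<lambda>B. real (block_degree E B) / real (card B)) ` P)"

end

theory Submission
  imports Defs "HOL-Library.Nat_Bijection"
begin

text \<open>Each block has \<open>t\<close> vertices. If the transversal can only use a set \<open>A\<close> of vertices of a
  block, then joining a vertex \<open>x\<close> of another block to all of \<open>A\<close> excludes \<open>x\<close> from every
  independent transversal. Arrange the blocks in a tree such that in a block at depth \<open>d\<close> exactly
  \<open>t - d\<close> vertices are excluded in this way, each by its own child block, where \<open>d + 1\<close> vertices
  are usable. At the root everything is excluded. A block at depth \<open>d\<close> has degree at most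
  \<open>(t - d) (d + 1) + d \<le> t\<^sup>2 / 4 + O(t)\<close>, and the edges form disjoint stars.\<close>

section \<open>Forests and injective relabelling\<close>

text \<open>At a vertex of maximal height \<open>h\<close> on a cycle, both cyclic neighbours would
  have to be its parent, but they are distinct since a cycle has at least three vertices.\<close>

lemma not_is_cycle_if_parent:
  fixes h :: "'a \<Rightarrow> nat"
  assumes E: "\<And>e. e \<in> E \<Longrightarrow> \<exists>y. e = {y, par y} \<and> h (par y) < h y"
  shows "\<not> is_cycle E c"
proof
  assume c: "is_cycle E c"
  define n where "n = length c"
  have n: "n \<ge> 3" and dist: "distinct c"
    and step: "\<And>i. i < n \<Longrightarrow> {c ! i, c ! (Suc i mod n)} \<in> E"
    using c by (auto simp: is_cycle_def n_def)
  obtain i where i: "i < n" and max: "\<And>j. j < n \<Longrightarrow> h (c ! j) \<le> h (c ! i)"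
  proof -
    have "Max ((\<lambda>i. h (c ! i)) ` {..<n}) \<in> (\<lambda>i. h (c ! i)) ` {..<n}"
      using n by (intro Max_in) (auto simp: lessThan_empty_iff)
    then obtain i where "i < n" "Max ((\<lambda>i. h (c ! i)) ` {..<n}) = h (c ! i)" by auto
    then show thesis using that[of i] by (metis Max_ge finite_imageI finite_lessThan imageI lessThan_iff)
  qed
  \<comment> \<open>The child end \<open>y\<close> of the edge cannot be \<open>c ! j\<close>, as it
    would then be higher than the maximal \<open>c ! i\<close>.\<close>
  have nb: "c ! j = par (c ! i)" if j: "j < n" and e: "{c ! i, c ! j} \<in> E" for j
  proof -
    obtain y where y: "{c ! i, c ! j} = {y, par y}" "h (par y) < h y"
      using E[OF e] by blast
    then show ?thesis using max[OF j] by (auto simp: doubleton_eq_iff)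
  qed
  \<comment> \<open>\<open>j\<close> and \<open>k\<close> are the cyclic predecessor and successor
    of \<open>i\<close>; they would coincide on a cycle of length 2.\<close>
  define j where "j = (if i = 0 then n - 1 else i - 1)"
  define k where "k = Suc i mod n"
  have j: "j < n" "Suc j mod n = i" using i n by (auto simp: j_def)
  have k: "k < n" using n by (simp add: k_def)
  have "c ! k = par (c ! i)" using nb[OF k] step[OF i] by (simp add: k_def)
  moreover have "c ! j = par (c ! i)"
    using nb[OF j(1)] step[OF j(1)] j(2) by (simp add: insert_commute)
  ultimately have "j = k" using dist j(1) k by (metis n_def nth_eq_iff_index_eq)
  moreover have "j \<noteq> k" using i n by (cases "Suc i = n") (auto simp: j_def k_def)
  ultimately show False by contradiction
qed

section \<open>Invariance under injective relabelling of vertices\<close>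

context
  fixes f :: "'a \<Rightarrow> 'b"
  assumes f: "inj f"
begin

lemma is_cycle_image:
  assumes "is_cycle ((`) f ` E) c"
  shows "is_cycle E (map (inv f) c)"
proof -
  have n: "length c \<ge> 3" and dist: "distinct c"
    and step: "\<And>i. i < length c \<Longrightarrow> {c ! i, c ! (Suc i mod length c)} \<in> (`) f ` E"
    using assms by (auto simp: is_cycle_def)
  have edge: "{inv f (c ! i), inv f (c ! (Suc i mod length c))} \<in> E" if i: "i < length c" for i
  proof -
    obtain e where e: "e \<in> E" "{c ! i, c ! (Suc i mod length c)} = f ` e"
      using step[OF i] by auto
    have "inv f ` {c ! i, c ! (Suc i mod length c)} = e"
      unfolding e(2) using f by (simp add: image_image)
    then show ?thesis using e(1) by simp
  qed
  \<comment> \<open>Every vertex of a cycle lies on an edge, hence in the range of \<open>f\<close>,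
    where \<open>inv f\<close> is injective.\<close>
  have "c ! i \<in> range f" if "i < length c" for i
    using step[OF that] by auto
  then have "set c \<subseteq> range f" by (auto simp: in_set_conv_nth)
  then have "inj_on (inv f) (set c)" by (rule inj_on_inv_into)
  moreover have "Suc i mod length c < length c" for i
    using n by (intro mod_less_divisor) linarith
  ultimately show ?thesis
    using n dist edge by (simp add: is_cycle_def distinct_map)
qed

lemma is_forest_image:
  assumes "is_forest V E"
  shows "is_forest (f ` V) ((`) f ` E)"
proof -
  have "finite_simple_graph (f ` V) ((`) f ` E)"
    using assms f
    by (auto simp: is_forest_def finite_simple_graph_def card_image inj_on_subset)
  then show ?thesis using assms is_cycle_image unfolding is_forest_def by blast
qed

lemma partition_on_image:
  assumes "partition_on V P"
  shows "partition_on (f ` V) ((`) f ` P)"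
proof (rule partition_onI)
  show "\<Union> ((`) f ` P) = f ` V" using assms by (auto simp: partition_on_def)
  show "disjnt A B" if AB: "A \<in> (`) f ` P" "B \<in> (`) f ` P" "A \<noteq> B" for A B
  proof -
    obtain A' B' where "A' \<in> P" "B' \<in> P" "A = f ` A'" "B = f ` B'" using AB by blast
    moreover from this have "A' \<inter> B' = {}"
      using AB partition_onD2[OF assms] by (metis disjointD)
    ultimately show ?thesis using f by (simp add: disjnt_def image_Int[symmetric])
  qed
  show "{} \<notin> (`) f ` P" using assms by (auto simp: partition_on_def)
qed

lemma card_image_Int: "card (f ` A \<inter> f ` B) = card (A \<inter> B)"
  using f by (metis card_image image_Int inj_on_subset subset_UNIV)

lemma block_degree_image: "block_degree ((`) f ` E) (f ` B) = block_degree E B"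
proof -
  have "{e \<in> (`) f ` E. card (e \<inter> f ` B) = 1} = (`) f ` {e \<in> E. card (e \<inter> B) = 1}"
    by (auto simp: card_image_Int)
  moreover have "inj ((`) f)" using f by (simp add: inj_image_eq_iff inj_def)
  ultimately show ?thesis by (simp add: block_degree_def card_image inj_on_subset)
qed

lemma max_block_average_degree_image:
  "max_block_average_degree ((`) f ` E) ((`) f ` P) = max_block_average_degree E P"
  using f by (simp add: max_block_average_degree_def image_image block_degree_image card_image inj_on_subset)

lemma thick_image: "thick t P \<Longrightarrow> thick t ((`) f ` P)"
  using f by (simp add: thick_def card_image inj_on_subset)

lemma independent_transversal_image:
  assumes "independent_transversal (f ` V) ((`) f ` E) ((`) f ` P) T"
  shows "\<exists>S. independent_transversal V E P S"
proof -
  have "T \<subseteq> f ` V" using assms by (simp add: independent_transversal_def independent_set_def)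
  then obtain S where S: "S \<subseteq> V" "T = f ` S" by (auto simp: subset_image_iff)
  then have "independent_transversal V E P S"
    using assms f
    by (simp add: independent_transversal_def independent_set_def card_image_Int inj_image_subset_iff)
  then show ?thesis ..
qed

end

section \<open>The construction on lists\<close>

text \<open>The list \<open>v # p\<close> is a vertex of the block indexed by \<open>p\<close>, and \<open>length p\<close> is the depth of
  that block. An excluded vertex \<open>x\<close> is joined to the usable vertices of the child block indexed
  by \<open>x\<close> itself.\<close>

primrec excluded :: "nat \<Rightarrow> nat list \<Rightarrow> bool" where
  "excluded t [] \<longleftrightarrow> False"
| "excluded t (v # p) \<longleftrightarrow> v + length p < t"

text \<open>The tree may stop at depth \<open>t\<close>, since a block there has no excluded vertex.
  A block whose index is not excluded is merely not joined to a parent block.\<close>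

definition indices :: "nat \<Rightarrow> nat list set" where
  "indices t = {p. set p \<subseteq> {..<t} \<and> length p \<le> t}"

definition block :: "nat \<Rightarrow> nat list \<Rightarrow> nat list set" where
  "block t p = (\<lambda>v. v # p) ` {..<t}"

definition vertices :: "nat \<Rightarrow> nat list set" where
  "vertices t = \<Union> (block t ` indices t)"

definition edges :: "nat \<Rightarrow> nat list set set" where
  "edges t = {{x, w # x} | x w. x \<in> indices t \<and> w < t \<and> excluded t x \<and> \<not> excluded t (w # x)}"

lemma finite_indices: "finite (indices t)"
  unfolding indices_def by (rule finite_lists_length_le) simp

lemma card_block [simp]: "card (block t p) = t"
  by (simp add: block_def card_image inj_on_def)

text \<open>The only index that is not a vertex is the empty list, and it is not excluded.\<close>

lemma excluded_in_vertices: "x \<in> indices t \<Longrightarrow> excluded t x \<Longrightarrow> x \<in> vertices t"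
  by (cases x) (auto simp: vertices_def block_def indices_def)

lemma is_forest_construction: "is_forest (vertices t) (edges t)"
proof -
  \<comment> \<open>Every edge joins a list to its tail, so \<open>tl\<close> is the parent map and
    \<open>length\<close> the height.\<close>
  have "\<exists>y. e = {y, tl y} \<and> length (tl y) < length y" if e: "e \<in> edges t" for e
  proof -
    obtain x w where "e = {x, w # x}" using e unfolding edges_def by blast
    then show ?thesis by (intro exI[of _ "w # x"]) auto
  qed
  then have "\<not> is_cycle (edges t) c" for c
    by (rule not_is_cycle_if_parent)
  moreover have "finite (vertices t)"
    by (auto simp: vertices_def finite_indices block_def)
  moreover have "e \<subseteq> vertices t \<and> card e = 2" if e: "e \<in> edges t" for e
  proof -
    obtain x w where xw: "e = {x, w # x}" "x \<in> indices t" "w < t" "excluded t x"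
      using e unfolding edges_def by blast
    then have "w # x \<in> vertices t" by (auto simp: vertices_def block_def)
    then show ?thesis using xw excluded_in_vertices by simp
  qed
  ultimately show ?thesis by (auto simp: is_forest_def finite_simple_graph_def)
qed

lemma partition_on_construction:
  assumes "t > 0"
  shows "partition_on (vertices t) (block t ` indices t)"
  using assms by (auto simp: partition_on_def vertices_def block_def disjoint_def)

section \<open>Block degrees\<close>

lemma block_degree_construction_le:
  "block_degree (edges t) (block t p) \<le> (t - length p) * (length p + 1) + t"
proof -
  define d where "d = length p"
  \<comment> \<open>\<open>A\<close> covers the edges to child blocks: \<open>t - d\<close> excluded
    vertices, each with at most \<open>d + 1\<close> usable neighbours. \<open>B\<close> covers the
    edges to the parent block; the crude bound \<open>t\<close> on their number adds only 1 to the
    average degree.\<close>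
  define A where "A = (\<lambda>(v, w). {v # p, w # v # p}) ` ({..<t - d} \<times> {t - (d + 1)..<t})"
  define B where "B = (\<lambda>w. {p, w # p}) ` {..<t}"
  have "{e \<in> edges t. card (e \<inter> block t p) = 1} \<subseteq> A \<union> B"
  proof
    fix e assume e: "e \<in> {e \<in> edges t. card (e \<inter> block t p) = 1}"
    then obtain x w where xw: "e = {x, w # x}" "w < t" "excluded t x" "\<not> excluded t (w # x)"
      by (auto simp: edges_def)
    have "e \<inter> block t p \<noteq> {}" using e by (metis (mono_tags) card.empty mem_Collect_eq zero_neq_one)
    then consider "x \<in> block t p" | "w # x \<in> block t p" using xw(1) by auto
    then show "e \<in> A \<union> B"
    proof cases
      case 1
      then obtain v where "x = v # p" by (auto simp: block_def)
      then show ?thesis using xw by (auto simp: A_def d_def intro!: image_eqI[where x = "(v, w)"])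
    next
      case 2
      then show ?thesis using xw by (auto simp: B_def block_def)
    qed
  qed
  then have "block_degree (edges t) (block t p) \<le> card (A \<union> B)"
    unfolding block_degree_def by (rule card_mono[rotated]) (auto simp: A_def B_def)
  also have "\<dots> \<le> card A + card B" by (rule card_Un_le)
  also have "card A \<le> card ({..<t - d} \<times> {t - (d + 1)..<t})"
    unfolding A_def by (rule card_image_le) simp
  also have "\<dots> = (t - d) * (t - (t - (d + 1)))" by (simp add: card_cartesian_product)
  also have "\<dots> \<le> (t - d) * (d + 1)" by (intro mult_le_mono2) simp
  also have "card B \<le> t" unfolding B_def using card_image_le[of "{..<t}"] by force
  finally show ?thesis by (simp add: d_def)
qed

lemma max_block_average_degree_construction_le:
  assumes "t > 0"
  shows "max_block_average_degree (edges t) (block t ` indices t) \<le> real t / 4 + 2"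
proof -
  have "real (block_degree (edges t) (block t p)) / real (card (block t p)) \<le> real t / 4 + 2"
    if p: "p \<in> indices t" for p
  proof -
    define d where "d = real (length p)"
    have "length p \<le> t" using p by (simp add: indices_def)
    then have "real ((t - length p) * (length p + 1) + t) = (real t - d) * (d + 1) + real t"
      by (simp only: d_def of_nat_diff of_nat_add of_nat_mult of_nat_1)
    then have "real (block_degree (edges t) (block t p)) \<le> (real t - d) * (d + 1) + real t"
      using block_degree_construction_le[of t p] by (metis of_nat_mono)
    \<comment> \<open>The factors \<open>t - d\<close> and \<open>d + 1\<close> have sum
      \<open>t + 1\<close> and difference \<open>t - 1 - 2 * d\<close>, so this is the AM-GM
      inequality.\<close>
    also have "\<dots> \<le> (real t + 1)\<^sup>2 / 4 + real t"
      using zero_le_power2[of "real t - 1 - 2 * d"] by (simp add: power2_eq_square field_simps)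
    \<comment> \<open>The lower-order terms \<open>3 * t / 2 + 1 / 4\<close> are at most
      \<open>2 * t\<close> because \<open>t\<close> is at least 1.\<close>
    also have "\<dots> \<le> (real t / 4 + 2) * real t"
      using assms by (simp add: power2_eq_square algebra_simps)
    finally show ?thesis using assms by (simp add: divide_le_eq)
  qed
  moreover have "indices t \<noteq> {}" by (auto simp: indices_def intro: exI[of _ "[]"])
  ultimately show ?thesis
    by (simp add: max_block_average_degree_def finite_indices)
qed

section \<open>Absence of an independent transversal\<close>

lemma transversal_meets_block:
  assumes "independent_transversal (vertices t) (edges t) (block t ` indices t) T"
    and "p \<in> indices t"
  obtains v where "v < t" "v # p \<in> T"
proof -
  have "card (T \<inter> block t p) = 1"
    using assms by (simp add: independent_transversal_def)
  then have "T \<inter> block t p \<noteq> {}" by (metis card.empty zero_neq_one)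
  then show thesis using that by (auto simp: block_def)
qed

text \<open>Induction from the leaves towards the root. If \<open>T\<close> contained an excluded
  vertex, its choice in the child block would be usable by induction, hence adjacent to that vertex.
  At depth \<open>t\<close> nothing is excluded.\<close>

lemma transversal_not_excluded:
  assumes T: "independent_transversal (vertices t) (edges t) (block t ` indices t) T"
    and "p \<in> indices t" "v < t" "v # p \<in> T"
  shows "\<not> excluded t (v # p)"
  using assms(2-)
proof (induction "t - length p" arbitrary: p v)
  case 0
  then show ?case by simp
next
  case (Suc n)
  show ?case
  proof
    assume ex: "excluded t (v # p)"
    then have child: "v # p \<in> indices t" using Suc by (simp add: indices_def)
    then obtain w where w: "w < t" "w # v # p \<in> T"
      using transversal_meets_block[OF T] by blast
    then have "\<not> excluded t (w # v # p)" using Suc child by (intro Suc.hyps) auto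
    then have "{v # p, w # v # p} \<in> edges t" using child w ex unfolding edges_def by blast
    then show False using T Suc.prems w by (auto simp: independent_transversal_def independent_set_def)
  qed
qed

lemma no_independent_transversal_construction:
  "\<not> independent_transversal (vertices t) (edges t) (block t ` indices t) T"
proof
  assume T: "independent_transversal (vertices t) (edges t) (block t ` indices t) T"
  have root: "[] \<in> indices t" by (simp add: indices_def)
  then obtain v where "v < t" "[v] \<in> T" using transversal_meets_block[OF T] by blast
  \<comment> \<open>At depth 0 every \<open>v < t\<close> is excluded.\<close>
  then show False using transversal_not_excluded[OF T root] by simp
qed

theorem theorem1p3:
  shows "\<forall>\<epsilon>::real. \<epsilon> > 0 \<longrightarrow>
    (\<exists>t0::nat. \<forall>t::nat. t \<ge> t0 \<longrightarrow>
      (\<exists>(V :: nat set) (E :: nat set set) (P :: nat set set).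
         is_forest V E \<and>
         partition_on V P \<and>
         thick t P \<and>
         max_block_average_degree E P \<le> (1 / 4 + \<epsilon>) * real t \<and>
         \<not> (\<exists>T. independent_transversal V E P T)))"
proof (intro allI impI)
  fix \<epsilon> :: real assume \<epsilon>: "\<epsilon> > 0"
  \<comment> \<open>With this choice the additive error 2 is absorbed by
    \<open>\<epsilon> * t\<close>.\<close>
  obtain t0 :: nat where t0: "2 / \<epsilon> < real t0" using reals_Archimedean2 by blast
  show "\<exists>t0::nat. \<forall>t::nat. t \<ge> t0 \<longrightarrow>
      (\<exists>(V :: nat set) (E :: nat set set) (P :: nat set set).
         is_forest V E \<and> partition_on V P \<and> thick t P \<and>
         max_block_average_degree E P \<le> (1 / 4 + \<epsilon>) * real t \<and>
         \<not> (\<exists>T. independent_transversal V E P T))"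
  proof (intro exI[of _ t0] allI impI)
    fix t assume "t \<ge> t0"
    then have large: "2 / \<epsilon> < real t" using t0 by linarith
    moreover have "2 / \<epsilon> > 0" using \<epsilon> by simp
    ultimately have t: "t > 0" by (metis less_trans of_nat_0_less_iff)
    \<comment> \<open>The encoding moves the construction from lists to natural numbers.\<close>
    let ?f = list_encode
    let ?V = "?f ` vertices t" and ?E = "(`) ?f ` edges t" and ?P = "(`) ?f ` block t ` indices t"
    have inj: "inj ?f" by (rule inj_list_encode)
    have "max_block_average_degree ?E ?P \<le> real t / 4 + 2"
      using max_block_average_degree_construction_le[OF t]
      by (simp only: max_block_average_degree_image[OF inj])
    also have "\<dots> \<le> (1 / 4 + \<epsilon>) * real t"
      using large \<epsilon> by (simp add: field_simps)
    finally have "max_block_average_degree ?E ?P \<le> (1 / 4 + \<epsilon>) * real t" .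
    moreover have "is_forest ?V ?E"
      by (intro is_forest_image inj is_forest_construction)
    moreover have "partition_on ?V ?P"
      by (intro partition_on_image inj partition_on_construction t)
    moreover have "thick t ?P"
      by (intro thick_image inj) (simp add: thick_def)
    moreover have "\<not> (\<exists>T. independent_transversal ?V ?E ?P T)"
      using independent_transversal_image[OF inj] no_independent_transversal_construction by blast
    ultimately show "\<exists>V E P. is_forest V E \<and> partition_on V P \<and> thick t P \<and>
         max_block_average_degree E P \<le> (1 / 4 + \<epsilon>) * real t \<and>
         \<not> (\<exists>T::nat set. independent_transversal V E P T)" by blast
  qed
qed

end
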